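(* Let $\mu\neq 0,\infty$ be a measure on $\mathbb{R}$ or on $\mathbb{T}$ that is uniformly $n$-adic doubling for all integers $n\ge 2$. Then $\mu$ is doubling.
   Context: $\mathbb{T}$ is the torus $[0,1]$ with the points $0$ and $1$ identified. The condition $\mu\neq 0,\infty$ means that $\mu$ is neither the zero measure nor identically infinite. All intervals are bounded, half-open, containing their left endpoint. A measure $\mu$ is doubling if there is a constant $C>0$ (which may depend on $\mu$ but not on the intervals) such that $\mu(I_1)\le C\mu(I_2)$ for any two adjacent intervals $I_1,I_2$ of equal length. For an integer $n\ge 2$, an $n$-adic interval in $\mathbb{R}$ is an interval $\left[\frac{k-1}{n^m},\frac{k}{n^m}\right)$ with $m,k\in\mathbb{Z}$. Its $n$ children are $\left[\frac{k-1}{n^m}+\frac{j-1}{n^{m+1}},\frac{k-1}{n^m}+\frac{j}{n^{m+1}}\right)$, $1\le j\le n$. Two $n$-adic intervals are $n$-adic siblings if they are children of a common $n$-adic interval. On $\mathbb{T}$, the $n$-adic intervals are those contained in $[0,1)$ (hence of length at most $1$). A measure $\mu$ is $n$-adic doubling with constant $C(n)>0$ if $\mu(J_1)\le C(n)\mu(J_2)$ for all $n$-adic siblings $J_1,J_2$. It is uniformly $n$-adic doubling if the constant $C(n)$ can be chosen to be a single constant, simultaneously for all integers $n\ge 2$.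
   Formalization: On ℝ the condition μ≠0,∞ is required on each of (-∞,0) and [0,∞) separately, since n-adic siblings never straddle 0 and Lebesgue measure on [0,∞) is a counterexample otherwise; "infinite" means infinite on every nonempty interval. The case of 𝕋 is as stated. *)

theory Defs
  imports "HOL-Analysis.Analysis"
begin

text \<open>
  The torus is modelled on its fundamental domain \<open>[0,1)\<close>: under the bijection
  \<open>[0,1) \<rightarrow> \<T>\<close> its Borel sigma-algebra is the trace of the Borel sets of the line.
\<close>

definition borel_torus :: "real measure" where
  "borel_torus = restrict_space borel {0..<1}"

definition adic_interval :: "nat \<Rightarrow> int \<Rightarrow> int \<Rightarrow> real set" where
  "adic_interval n m k =
     {(real_of_int k - 1) / real n powi m ..< real_of_int k / real n powi m}"

definition adic_child :: "nat \<Rightarrow> int \<Rightarrow> int \<Rightarrow> nat \<Rightarrow> real set" where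
  "adic_child n m k j =
     {(real_of_int k - 1) / real n powi m + (real j - 1) / real n powi (m + 1) ..<
      (real_of_int k - 1) / real n powi m + real j / real n powi (m + 1)}"

text \<open>
  The parameter \<open>X\<close> is \<open>UNIV\<close> for the line and \<open>[0,1)\<close> for the torus. It is the common
  parent that has to lie in \<open>X\<close>, so \<open>[0,1)\<close> has no siblings but itself on the torus.
\<close>

definition adic_siblings :: "real set \<Rightarrow> nat \<Rightarrow> real set \<Rightarrow> real set \<Rightarrow> bool" where
  "adic_siblings X n J1 J2 \<longleftrightarrow>
     (\<exists>m k. adic_interval n m k \<subseteq> X \<and>
        (\<exists>i\<in>{1..n}. \<exists>j\<in>{1..n}. J1 = adic_child n m k i \<and> J2 = adic_child n m k j))"

definition adic_doubling :: "real set \<Rightarrow> real measure \<Rightarrow> nat \<Rightarrow> real \<Rightarrow> bool" where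
  "adic_doubling X \<mu> n C \<longleftrightarrow>
     (\<forall>J1 J2. adic_siblings X n J1 J2 \<longrightarrow> emeasure \<mu> J1 \<le> ennreal C * emeasure \<mu> J2)"

definition uniformly_adic_doubling :: "real set \<Rightarrow> real measure \<Rightarrow> bool" where
  "uniformly_adic_doubling X \<mu> \<longleftrightarrow> (\<exists>C>0. \<forall>n\<ge>2. adic_doubling X \<mu> n C)"

definition adjacent_line :: "real set \<Rightarrow> real set \<Rightarrow> bool" where
  "adjacent_line I1 I2 \<longleftrightarrow>
     (\<exists>a l. 0 < l \<and>
        (I1 = {a..<a + l} \<and> I2 = {a + l..<a + 2 * l} \<or>
         I1 = {a + l..<a + 2 * l} \<and> I2 = {a..<a + l}))"

text \<open>
  Intervals of the torus are the images of intervals of the line under the quotient map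
  \<open>frac\<close>, so they may wrap around \<open>0\<close>; two adjacent ones of length \<open>l\<close> fit without
  overlapping precisely when \<open>2 * l \<le> 1\<close>.
\<close>

definition adjacent_torus :: "real set \<Rightarrow> real set \<Rightarrow> bool" where
  "adjacent_torus I1 I2 \<longleftrightarrow>
     (\<exists>a l. 0 < l \<and> 2 * l \<le> 1 \<and>
        (I1 = frac ` {a..<a + l} \<and> I2 = frac ` {a + l..<a + 2 * l} \<or>
         I1 = frac ` {a + l..<a + 2 * l} \<and> I2 = frac ` {a..<a + l}))"

definition doubling :: "(real set \<Rightarrow> real set \<Rightarrow> bool) \<Rightarrow> real measure \<Rightarrow> bool" where
  "doubling adjacent \<mu> \<longleftrightarrow>
     (\<exists>C>0. \<forall>I1 I2. adjacent I1 I2 \<longrightarrow> emeasure \<mu> I1 \<le> ennreal C * emeasure \<mu> I2)"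

text \<open>
  The condition \<open>\<mu> \<noteq> 0, \<infinity>\<close> on \<open>X\<close>; identically infinite means infinite on every
  nonempty interval (a measure cannot be infinite on the empty set).
\<close>

definition nondegenerate_on :: "real set \<Rightarrow> real measure \<Rightarrow> bool" where
  "nondegenerate_on X \<mu> \<longleftrightarrow>
     emeasure \<mu> X \<noteq> 0 \<and> (\<exists>a b. a < b \<and> {a..<b} \<subseteq> X \<and> emeasure \<mu> {a..<b} \<noteq> \<infinity>)"

text \<open>
  No adic interval of the line contains \<open>0\<close> in its interior, so adic doubling never relates
  the two half-lines, and each of them has to be nondegenerate: Lebesgue measure
  on \<open>[0,\<infinity>)\<close>, extended by zero, shows that nondegeneracy on the whole line does not suffice.
\<close>

lemma nondegenerate_line_not_sufficient:
  defines "\<mu> \<equiv> density lborel (indicator {0..}) :: real measure"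
  shows "sets \<mu> = sets borel" "nondegenerate_on UNIV \<mu>"
    "uniformly_adic_doubling UNIV \<mu>" "\<not> doubling adjacent_line \<mu>"
proof -
  have em: "emeasure \<mu> A = emeasure lborel ({0..} \<inter> A)" if "A \<in> sets borel" for A
    using that unfolding \<mu>_def
    by (subst emeasure_density) (auto simp flip: indicator_inter_arith)
  have pos: "emeasure \<mu> {a..<b} = ennreal (b - a)" if "0 \<le> a" "a \<le> b" for a b
  proof -
    have "{0..} \<inter> {a..<b} = {a..<b}" using that by auto
    then show ?thesis using that by (simp add: em)
  qed
  have neg: "emeasure \<mu> {a..<b} = 0" if "b \<le> 0" for a b
  proof -
    have "{0..} \<inter> {a..<b} = {}" using that by auto
    then show ?thesis by (simp add: em)
  qed
  show "sets \<mu> = sets borel" by (simp add: \<mu>_def)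
  have "emeasure \<mu> {0..<1} \<le> emeasure \<mu> UNIV"
    by (rule emeasure_mono) (auto simp: \<mu>_def)
  then have "emeasure \<mu> UNIV \<noteq> 0" using pos[of 0 1] by auto
  moreover have "\<exists>a b. a < b \<and> {a..<b} \<subseteq> UNIV \<and> emeasure \<mu> {a..<b} \<noteq> \<infinity>"
    by (rule exI[of _ 0], rule exI[of _ 1]) (simp add: pos)
  ultimately show "nondegenerate_on UNIV \<mu>"
    unfolding nondegenerate_on_def by blast
  have child: "emeasure \<mu> (adic_child n m k i) =
      (if k \<ge> 1 then ennreal (1 / real n powi (m + 1)) else 0)"
    if n: "n \<ge> 2" and i: "i \<in> {1..n}" for n m k i
  proof (cases "k \<ge> 1")
    case True
    have "0 \<le> (real_of_int k - 1) / real n powi m + (real i - 1) / real n powi (m + 1)"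
      using True i by (intro add_nonneg_nonneg divide_nonneg_nonneg) auto
    moreover have "(real i - 1) / real n powi (m + 1) \<le> real i / real n powi (m + 1)"
      by (intro divide_right_mono) auto
    ultimately show ?thesis
      using True unfolding adic_child_def
      by (subst pos) (auto simp flip: diff_divide_distrib)
  next
    case False
    have p: "real n powi m > 0" using n by simp
    have "real i / real n powi (m + 1) \<le> real n / real n powi (m + 1)"
      using i by (intro divide_right_mono) auto
    also have "\<dots> = 1 / real n powi m"
      using n by (simp add: power_int_add)
    finally have "(real_of_int k - 1) / real n powi m + real i / real n powi (m + 1)
        \<le> (real_of_int k - 1) / real n powi m + 1 / real n powi m" by simp
    also have "\<dots> = real_of_int k / real n powi m" by (simp add: diff_divide_distrib)
    also have "\<dots> \<le> 0" using False p by (intro divide_nonpos_pos) auto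
    finally show ?thesis using False unfolding adic_child_def by (simp add: neg)
  qed
  show "uniformly_adic_doubling UNIV \<mu>"
    unfolding uniformly_adic_doubling_def adic_doubling_def adic_siblings_def
    by (rule exI[of _ 1]) (auto simp: child)
  show "\<not> doubling adjacent_line \<mu>"
  proof
    assume "doubling adjacent_line \<mu>"
    then obtain C where
      "\<And>I1 I2. adjacent_line I1 I2 \<Longrightarrow> emeasure \<mu> I1 \<le> ennreal C * emeasure \<mu> I2"
      unfolding doubling_def by blast
    moreover have "adjacent_line {0..<1} {-1..<0}"
      unfolding adjacent_line_def by (rule exI[of _ "-1"], rule exI[of _ 1]) auto
    ultimately have "emeasure \<mu> {0..<1} \<le> ennreal C * emeasure \<mu> {-1..<0}" by blast
    then show False using pos[of 0 1] neg[of 0 "-1"] by simp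
  qed
qed

end

theory Submission
  imports Defs
begin

text \<open>
  If all \<open>n\<close> children of a unit interval have masses comparable with a constant \<open>C\<close> that does not
  depend on \<open>n\<close>, then letting \<open>n\<close> grow shows that \<open>\<mu>\<close> is comparable to a multiple of Lebesgue
  measure on that unit interval. On each half-line all unit intervals are in turn comparable, being
  children of \<open>[0,n)\<close> or \<open>[-n,0)\<close> for large \<open>n\<close>. So \<open>\<mu>\<close> is comparable to Lebesgue
  measure, with constants depending on \<open>\<mu>\<close>; this also takes care of intervals crossing \<open>0\<close>.
\<close>

section \<open>Grids of mesh \<open>1 / n\<close> and additivity over them\<close>

text \<open>Numbering from 0 by the left endpoint makes \<open>i div n\<close> the index of the unit
  interval that contains \<open>cell n i\<close>.\<close>

definition cell :: "nat \<Rightarrow> int \<Rightarrow> real set" where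
  "cell n i = {real_of_int i / real n ..< (real_of_int i + 1) / real n}"

lemma cell_1: "cell (Suc 0) k = {real_of_int k ..< real_of_int k + 1}"
  by (simp add: cell_def)

lemma mem_cell_iff:
  assumes "n > 0"
  shows "x \<in> cell n i \<longleftrightarrow> \<lfloor>x * real n\<rfloor> = i"
  using assms by (auto simp: cell_def field_simps floor_eq_iff)

lemma floor_eq_of_mem_cell:
  assumes "n > 0" "x \<in> cell n i"
  shows "\<lfloor>x\<rfloor> = i div int n"
proof -
  have "\<lfloor>x * real n / real_of_int (int n)\<rfloor> = \<lfloor>x * real n\<rfloor> div int n"
    by (rule floor_divide_real_eq_div) simp
  then show ?thesis using assms by (simp add: mem_cell_iff)
qed

lemma left_endpoint_mem_cell: "n > 0 \<Longrightarrow> real_of_int i / real n \<in> cell n i"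
  by (simp add: cell_def divide_strict_right_mono)

text \<open>\<open>K\<close> selects the unit intervals that make up the domain: a half-line, the
  whole line, or \<open>{0}\<close> for the torus. On the torus only subsets of \<open>[0,1)\<close>
  can be measurable, so measurability is asked only of intervals inside the domain, and line and
  torus share what follows.\<close>

definition intervals_measurable :: "int set \<Rightarrow> real measure \<Rightarrow> bool" where
  "intervals_measurable K M \<longleftrightarrow> (\<forall>a b. {a..<b} \<subseteq> {x. \<lfloor>x\<rfloor> \<in> K} \<longrightarrow> {a..<b} \<in> sets M)"

lemma cell_subset_iff:
  assumes "n > 0"
  shows "cell n i \<subseteq> {x. \<lfloor>x\<rfloor> \<in> K} \<longleftrightarrow> i div int n \<in> K"
  using floor_eq_of_mem_cell[OF assms] left_endpoint_mem_cell[OF assms] by fastforce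

lemma cell_in_sets:
  assumes "intervals_measurable K M" "n > 0" "i div int n \<in> K"
  shows "cell n i \<in> sets M"
  using assms cell_subset_iff[of n i K] unfolding intervals_measurable_def cell_def by blast

lemma grid_eq_UN_cell:
  assumes "n > 0"
  shows "{real_of_int p / real n ..< real_of_int q / real n} = (\<Union>i\<in>{p..<q}. cell n i)"
  using assms by (auto simp: mem_cell_iff field_simps floor_less_iff le_floor_iff)

lemma emeasure_grid:
  assumes "n > 0" "intervals_measurable K M" "\<And>i. i \<in> {p..<q} \<Longrightarrow> i div int n \<in> K"
  shows "emeasure M {real_of_int p / real n ..< real_of_int q / real n} =
    (\<Sum>i\<in>{p..<q}. emeasure M (cell n i))"
proof -
  have "disjoint_family_on (cell n) {p..<q}"
    using assms(1) by (auto simp: disjoint_family_on_def mem_cell_iff)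
  then show ?thesis
    unfolding grid_eq_UN_cell[OF assms(1)] using assms
    by (intro sum_emeasure[symmetric]) (auto intro: cell_in_sets)
qed

lemma emeasure_unit_eq_sum:
  assumes "n > 0" "intervals_measurable K M" "k \<in> K"
  shows "emeasure M (cell 1 k) = (\<Sum>i\<in>{k * int n..<(k + 1) * int n}. emeasure M (cell n i))"
proof -
  have "i div int n \<in> K" if "i \<in> {k * int n..<(k + 1) * int n}" for i
  proof -
    have "i div int n = k"
      by (rule int_div_pos_eq[of i "int n" k "i - k * int n"])
        (use that in \<open>auto simp: algebra_simps\<close>)
    then show ?thesis using assms by simp
  qed
  from emeasure_grid[OF assms(1,2), of "k * int n" "(k + 1) * int n", OF this] show ?thesis
    using assms(1) by (simp add: cell_1)
qed

section \<open>From bounds on cells to bounds on arbitrary intervals\<close>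

lemma ennreal_real_mult: "c \<ge> 0 \<Longrightarrow> ennreal (real m * c) = of_nat m * ennreal c"
  by (simp add: ennreal_mult ennreal_of_nat_eq_real_of_nat)

text \<open>Inner and outer approximation by unions of cells on a fine grid; the factors
  \<open>1 / 2\<close> and \<open>2\<close> absorb the rounding of the endpoints. Cells of different
  unit intervals are simply summed, so an interval may cross integers, 0 included.\<close>

lemma interval_bounds:
  fixes L U :: real
  assumes meas: "intervals_measurable K M"
    and L: "L > 0" and U: "U > 0"
    and lower: "\<And>n i. n \<ge> 2 \<Longrightarrow> i div int n \<in> K \<Longrightarrow> ennreal (L / n) \<le> emeasure M (cell n i)"
    and upper: "\<And>n i. n \<ge> 2 \<Longrightarrow> i div int n \<in> K \<Longrightarrow> emeasure M (cell n i) \<le> ennreal (U / n)"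
    and ab: "a < b" "{a..<b} \<subseteq> {x. \<lfloor>x\<rfloor> \<in> K}"
  shows "ennreal (L / 2 * (b - a)) \<le> emeasure M {a..<b}"
    and "emeasure M {a..<b} \<le> ennreal (2 * U * (b - a))"
proof -
  \<comment> \<open>Rounding the endpoints to the grid changes the length by at most \<open>2 / n\<close>, half of \<open>b - a\<close>.\<close>
  define n where "n = max 2 (nat \<lceil>4 / (b - a)\<rceil>)"
  have n2: "n \<ge> 2" and n0: "n > 0" by (auto simp: n_def)
  have "4 / (b - a) \<le> real n" by (simp add: n_def) linarith
  then have n4: "4 \<le> b * real n - a * real n"
    using ab by (simp add: field_simps)
  have sets_ab: "{a..<b} \<in> sets M"
    using meas ab unfolding intervals_measurable_def by blast
  \<comment> \<open>Having its left endpoint in \<open>{a..<b}\<close> already puts the whole cell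
    into the domain, even if it sticks out beyond \<open>b\<close>.\<close>
  have inner: "i div int n \<in> K" if "a * n \<le> i" "i < b * n" for i
  proof -
    have "real_of_int i / real n \<in> {a..<b}" using that n0 by (simp add: field_simps)
    then show ?thesis
      using ab(2) floor_eq_of_mem_cell[OF n0 left_endpoint_mem_cell[OF n0, of i]] by force
  qed
  show "ennreal (L / 2 * (b - a)) \<le> emeasure M {a..<b}"
  proof -
    define p q where "p = \<lceil>a * n\<rceil>" and "q = \<lfloor>b * n\<rfloor>"
    have K: "i div int n \<in> K" if "i \<in> {p..<q}" for i
      using that by (intro inner) (auto simp: p_def q_def ceiling_le_iff less_floor_iff)
    have "b * n - 1 < real_of_int q" "real_of_int p < a * n + 1"
      unfolding p_def q_def by linarith+
    then have len: "b * n - a * n \<le> 2 * real_of_int (q - p)"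
      using n4 unfolding of_int_diff by argo
    then have "real_of_int p \<le> real_of_int q" using n4 by simp
    then have pq: "p \<le> q" by simp
    have "L / 2 * (b - a) = (b * n - a * n) * (L / (2 * n))"
      using n0 by (simp add: field_simps)
    also have "\<dots> \<le> (2 * real_of_int (q - p)) * (L / (2 * n))"
      using len L by (intro mult_right_mono) auto
    also have "\<dots> = real (nat (q - p)) * (L / n)"
      using pq n0 by (simp add: field_simps)
    finally have "ennreal (L / 2 * (b - a)) \<le> ennreal (real (nat (q - p)) * (L / n))"
      by (rule ennreal_leI)
    also have "\<dots> = (\<Sum>i\<in>{p..<q}. ennreal (L / n))"
      using L by (simp add: ennreal_real_mult del: of_nat_nat times_divide_eq_right)
    also have "\<dots> \<le> (\<Sum>i\<in>{p..<q}. emeasure M (cell n i))"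
      using n2 K by (intro sum_mono lower) auto
    also have "\<dots> = emeasure M {real_of_int p / real n ..< real_of_int q / real n}"
      by (rule emeasure_grid[symmetric, OF n0 meas K])
    also have "\<dots> \<le> emeasure M {a..<b}"
    proof (rule emeasure_mono[OF _ sets_ab])
      have "a \<le> p / n" "q / n \<le> b" using n0 by (auto simp: p_def q_def field_simps)
      then show "{real_of_int p / real n ..< real_of_int q / real n} \<subseteq> {a..<b}" by auto
    qed
    finally show ?thesis .
  qed
  show "emeasure M {a..<b} \<le> ennreal (2 * U * (b - a))"
  proof -
    define p q where "p = \<lfloor>a * n\<rfloor>" and "q = \<lceil>b * n\<rceil>"
    have K: "i div int n \<in> K" if i: "i \<in> {p..<q}" for i
    proof (cases "a * n \<le> i")
      case True
      then show ?thesis using i by (intro inner) (auto simp: q_def less_ceiling_iff)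
    next
      case False
      \<comment> \<open>Only the first cell can start before \<open>a\<close>; it contains
        \<open>a\<close>, which lies in the domain.\<close>
      then have "i = \<lfloor>a * n\<rfloor>" using i unfolding p_def by (simp add: floor_le_iff) linarith
      then have "a \<in> cell n i" using n0 by (simp add: mem_cell_iff)
      then show ?thesis using floor_eq_of_mem_cell[OF n0] ab by force
    qed
    have pq': "a * n - 1 < real_of_int p" "real_of_int p \<le> a * n"
      "b * n \<le> real_of_int q" "real_of_int q < b * n + 1"
      unfolding p_def q_def by linarith+
    then have "real_of_int (q - p) \<le> (b * n - a * n) + 2"
      by simp
    then have len: "real_of_int (q - p) \<le> 2 * (b * n - a * n)"
      using n4 by simp
    have "real_of_int p \<le> real_of_int q" using n4 pq' by linarith
    then have pq: "p \<le> q" by simp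
    \<comment> \<open>The enlarged interval must not leave the domain, since otherwise it need not
      be measurable and monotonicity would fail.\<close>
    have "{real_of_int p / real n ..< real_of_int q / real n} \<subseteq> {x. \<lfloor>x\<rfloor> \<in> K}"
      unfolding grid_eq_UN_cell[OF n0] using K floor_eq_of_mem_cell[OF n0] by fastforce
    then have sets_pq: "{real_of_int p / real n ..< real_of_int q / real n} \<in> sets M"
      using meas unfolding intervals_measurable_def by blast
    have "emeasure M {a..<b} \<le> emeasure M {real_of_int p / real n ..< real_of_int q / real n}"
    proof (rule emeasure_mono[OF _ sets_pq])
      have "p / n \<le> a" "b \<le> q / n" using n0 by (auto simp: p_def q_def field_simps)
      then show "{a..<b} \<subseteq> {real_of_int p / real n ..< real_of_int q / real n}" by auto
    qed
    also have "\<dots> = (\<Sum>i\<in>{p..<q}. emeasure M (cell n i))"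
      by (rule emeasure_grid[OF n0 meas K])
    also have "\<dots> \<le> (\<Sum>i\<in>{p..<q}. ennreal (U / n))"
      using n2 K by (intro sum_mono upper) auto
    also have "\<dots> = ennreal (real (nat (q - p)) * (U / n))"
      using U by (simp add: ennreal_real_mult del: of_nat_nat times_divide_eq_right)
    also have "\<dots> \<le> ennreal (2 * U * (b - a))"
    proof (rule ennreal_leI)
      have "real (nat (q - p)) * (U / n) = real_of_int (q - p) * (U / n)"
        using pq by simp
      also have "\<dots> \<le> 2 * (b * n - a * n) * (U / n)"
        using len U by (intro mult_right_mono) auto
      also have "\<dots> = 2 * U * (b - a)" using n0 by (simp add: field_simps)
      finally show "real (nat (q - p)) * (U / n) \<le> 2 * U * (b - a)" .
    qed
    finally show ?thesis .
  qed
qed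

section \<open>Uniform bounds on the cells from comparability\<close>

text \<open>Fix a unit interval of mass \<open>u\<close> with \<open>0 < u < \<infinity>\<close>.
  Passing to another unit interval costs a factor \<open>C\<close>, and passing from there to the
  average share of its \<open>n\<close> cells costs another, so every cell has mass between
  \<open>u / C^2 / n\<close> and \<open>C^2 * u / n\<close>.\<close>

lemma cell_bounds:
  fixes C :: real
  assumes meas: "intervals_measurable K M"
    and C: "C > 0"
    and sib: "\<And>n i j. n \<ge> 2 \<Longrightarrow> i div int n \<in> K \<Longrightarrow> i div int n = j div int n \<Longrightarrow>
      emeasure M (cell n i) \<le> ennreal C * emeasure M (cell n j)"
    and unit: "\<And>k l. k \<in> K \<Longrightarrow> l \<in> K \<Longrightarrow>
      emeasure M (cell 1 k) \<le> ennreal C * emeasure M (cell 1 l)"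
    and nondeg: "nondegenerate_on {x. \<lfloor>x\<rfloor> \<in> K} M"
  obtains L U :: real where "L > 0" "U > 0"
    "\<And>n i. n \<ge> 2 \<Longrightarrow> i div int n \<in> K \<Longrightarrow> ennreal (L / n) \<le> emeasure M (cell n i)"
    "\<And>n i. n \<ge> 2 \<Longrightarrow> i div int n \<in> K \<Longrightarrow> emeasure M (cell n i) \<le> ennreal (U / n)"
proof -
  have div_eq: "j div int n = k" if "n \<ge> 2" "j \<in> {k * int n..<(k + 1) * int n}" for n k j
    by (rule int_div_pos_eq[of j "int n" k "j - k * int n"])
      (use that in \<open>auto simp: algebra_simps\<close>)
  have card: "card {k * int n..<(k + 1) * int n} = n" for k n
    by (simp add: algebra_simps)
  have unit_le: "emeasure M (cell 1 (i div int n)) \<le> of_nat n * (ennreal C * emeasure M (cell n i))"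
    if n: "n \<ge> 2" and i: "i div int n \<in> K" for n i
  proof -
    let ?R = "{(i div int n) * int n..<((i div int n) + 1) * int n}"
    have "emeasure M (cell 1 (i div int n)) = (\<Sum>j\<in>?R. emeasure M (cell n j))"
      using n i by (intro emeasure_unit_eq_sum[OF _ meas]) auto
    also have "\<dots> \<le> (\<Sum>j\<in>?R. ennreal C * emeasure M (cell n i))"
      using div_eq[OF n] i by (intro sum_mono sib n) auto
    finally show ?thesis using card by simp
  qed
  have le_unit: "of_nat n * emeasure M (cell n i) \<le> ennreal C * emeasure M (cell 1 (i div int n))"
    if n: "n \<ge> 2" and i: "i div int n \<in> K" for n i
  proof -
    let ?R = "{(i div int n) * int n..<((i div int n) + 1) * int n}"
    have "of_nat n * emeasure M (cell n i) = (\<Sum>j\<in>?R. emeasure M (cell n i))"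
      using card by simp
    also have "\<dots> \<le> (\<Sum>j\<in>?R. ennreal C * emeasure M (cell n j))"
      using div_eq[OF n] i by (intro sum_mono sib n) auto
    also have "\<dots> = ennreal C * emeasure M (cell 1 (i div int n))"
      using n i by (subst emeasure_unit_eq_sum[OF _ meas]) (auto simp: sum_distrib_left)
    finally show ?thesis .
  qed
  have UN: "{x. \<lfloor>x\<rfloor> \<in> K} = (\<Union>k\<in>K. cell 1 k)"
    by (auto simp: mem_cell_iff)
  \<comment> \<open>Otherwise the domain would be a countable union of null sets.\<close>
  obtain k0 where k0: "k0 \<in> K" "emeasure M (cell 1 k0) \<noteq> 0"
  proof -
    have "\<exists>k\<in>K. emeasure M (cell 1 k) \<noteq> 0"
    proof (rule ccontr)
      assume "\<not> ?thesis"
      then have "(\<Union>k\<in>K. cell 1 k) \<in> null_sets M"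
        by (intro null_sets_UN') (auto intro!: null_setsI cell_in_sets[OF meas] countableI_type)
      then show False using nondeg UN unfolding nondegenerate_on_def by auto
    qed
    then show ?thesis using that by blast
  qed
  obtain a b where ab: "a < b" "{a..<b} \<subseteq> {x. \<lfloor>x\<rfloor> \<in> K}" "emeasure M {a..<b} \<noteq> \<infinity>"
    using nondeg unfolding nondegenerate_on_def by blast
  \<comment> \<open>Finiteness spreads upwards: a grid with \<open>n * (b - a) \<ge> 2\<close> has a
    whole cell inside the interval of finite mass, then the unit interval around that cell is finite
    by \<open>unit_le\<close>, then \<open>cell 1 k0\<close> by \<open>unit\<close>.\<close>
  have fin: "emeasure M (cell 1 k0) < \<infinity>"
  proof -
    define n where "n = max 2 (nat \<lceil>2 / (b - a)\<rceil>)"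
    have n: "n \<ge> 2" by (simp add: n_def)
    have "2 / (b - a) \<le> real n" by (simp add: n_def) linarith
    then have n2: "2 \<le> b * real n - a * real n" using ab(1) by (simp add: field_simps)
    define i where "i = \<lceil>a * n\<rceil>"
    have "a * n \<le> i" "i + 1 \<le> b * n" using n2 unfolding i_def by linarith+
    then have "a \<le> i / n" "(i + 1) / n \<le> b" using n by (auto simp: field_simps)
    then have sub: "cell n i \<subseteq> {a..<b}" by (auto simp: cell_def)
    have i: "i div int n \<in> K" using ab(2) sub cell_subset_iff[of n i K] n by auto
    have "{a..<b} \<in> sets M" using meas ab(2) unfolding intervals_measurable_def by blast
    then have "emeasure M (cell n i) < \<infinity>"
      using emeasure_mono[OF sub, of M] ab(3) order_le_less_trans by (auto simp: less_top)
    then have "of_nat n * (ennreal C * emeasure M (cell n i)) < \<infinity>"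
      by (simp add: ennreal_mult_less_top of_nat_less_top)
    then have "emeasure M (cell 1 (i div int n)) < \<infinity>"
      using unit_le[OF n i] by (rule order_le_less_trans[rotated])
    then have "ennreal C * emeasure M (cell 1 (i div int n)) < \<infinity>"
      by (simp add: ennreal_mult_less_top)
    then show ?thesis using unit[OF k0(1) i] by (rule order_le_less_trans[rotated])
  qed
  define u where "u = measure M (cell 1 k0)"
  have u: "emeasure M (cell 1 k0) = ennreal u"
    using fin by (simp add: u_def emeasure_eq_ennreal_measure)
  have upos: "u > 0" using k0(2) u by (metis ennreal_eq_0_iff not_le)
  show ?thesis
  proof (rule that[of "u / C\<^sup>2" "C\<^sup>2 * u"])
    show "u / C\<^sup>2 > 0" "C\<^sup>2 * u > 0" using upos C by auto
  next
    fix n :: nat and i :: int assume n: "n \<ge> 2" and i: "i div int n \<in> K"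
    have "of_nat n * emeasure M (cell n i) \<le> ennreal C * emeasure M (cell 1 (i div int n))"
      by (rule le_unit[OF n i])
    also have "\<dots> \<le> ennreal C * (ennreal C * ennreal u)"
      using unit[OF i k0(1)] u by (intro mult_left_mono) auto
    finally have *: "of_nat n * emeasure M (cell n i) \<le> ennreal (C\<^sup>2 * u)"
      using C upos by (simp add: ennreal_mult[symmetric] power2_eq_square mult.assoc)
    \<comment> \<open>The mass has to be a real number \<open>r\<close> before the inequalities can
      be divided by \<open>n\<close> and \<open>C\<close>.\<close>
    have "emeasure M (cell n i) < \<infinity>"
    proof -
      have "of_nat n * emeasure M (cell n i) < \<infinity>"
        using * by (rule order_le_less_trans) simp
      then show ?thesis using n by (auto simp: ennreal_mult_less_top)
    qed
    then obtain r where r: "r \<ge> 0" "emeasure M (cell n i) = ennreal r"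
      by (cases "emeasure M (cell n i)") auto
    have "ennreal (n * r) \<le> ennreal (C\<^sup>2 * u)"
      using * r by (simp add: ennreal_mult ennreal_of_nat_eq_real_of_nat)
    then have "n * r \<le> C\<^sup>2 * u" using upos by (simp add: ennreal_le_iff)
    then have "r \<le> C\<^sup>2 * u / n" using n by (simp add: field_simps)
    then show "emeasure M (cell n i) \<le> ennreal (C\<^sup>2 * u / n)"
      unfolding r by (rule ennreal_leI)
    have "ennreal u \<le> ennreal C * emeasure M (cell 1 (i div int n))"
      using unit[OF k0(1) i] u by simp
    also have "\<dots> \<le> ennreal C * (of_nat n * (ennreal C * ennreal r))"
      using unit_le[OF n i] r by (intro mult_left_mono) auto
    also have "\<dots> = ennreal (C * (n * (C * r)))"
      using C r by (simp add: ennreal_mult ennreal_of_nat_eq_real_of_nat)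
    finally have "u \<le> C * (n * (C * r))" using C r by (simp add: ennreal_le_iff)
    then have "u / C\<^sup>2 / n \<le> r" using n C by (simp add: field_simps power2_eq_square)
    then show "ennreal (u / C\<^sup>2 / n) \<le> emeasure M (cell n i)"
      unfolding r by (rule ennreal_leI)
  qed
qed

section \<open>Adic siblings expressed by cells\<close>

text \<open>Division with remainder of \<open>i\<close> by \<open>n\<close>. The shifts by one
  translate between cells, counted from 0, and adic intervals and children, counted from 1.\<close>

lemma adic_child_0:
  assumes "n > 0" "k = i div int n"
  shows "adic_child n 0 (k + 1) (nat (i mod int n) + 1) = cell n i"
proof -
  have "real_of_int i = real_of_int (int n * k + i mod int n)"
    using assms(2) by simp
  then have "real_of_int i = real n * real_of_int k + real_of_int (i mod int n)"
    by (simp only: of_int_add of_int_mult of_int_of_nat_eq)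
  then have "real_of_int i / real n = real_of_int k + real_of_int (i mod int n) / real n"
    using assms(1) by (simp add: field_simps)
  moreover have "real (nat (i mod int n)) = real_of_int (i mod int n)"
    using assms(1) by simp
  ultimately show ?thesis
    by (simp add: adic_child_def cell_def add_divide_distrib add_ac)
qed

text \<open>Unit intervals are the adic intervals of level 0 for every \<open>n\<close> at once, so
  one parent serves all bases.\<close>

lemma adic_doubling_cell:
  assumes "adic_doubling X M n C" "n \<ge> 2" "cell 1 (i div int n) \<subseteq> X" "i div int n = j div int n"
  shows "emeasure M (cell n i) \<le> ennreal C * emeasure M (cell n j)"
proof -
  have n: "n > 0" using assms(2) by simp
  have mod: "nat (l mod int n) + 1 \<in> {1..n}" for l
    using n pos_mod_bound[of "int n" l] by (auto simp: Suc_le_eq nat_less_iff)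
  have "adic_interval n 0 (i div int n + 1) \<subseteq> X"
    using assms(3) by (simp add: adic_interval_def cell_1)
  then have "adic_siblings X n (cell n i) (cell n j)"
    unfolding adic_siblings_def
    using adic_child_0[OF n refl, of i] adic_child_0[OF n assms(4)] mod by metis
  then show ?thesis using assms(1) unfolding adic_doubling_def by blast
qed

text \<open>The base may depend on \<open>k\<close> and \<open>l\<close> because \<open>C\<close>
  does not depend on the base: for large \<open>n\<close>, two unit intervals on the same side of 0
  are children of the same interval \<open>[0,n)\<close> or \<open>[-n,0)\<close> of level
  -1.\<close>

lemma adic_doubling_unit:
  assumes "\<And>n. n \<ge> 2 \<Longrightarrow> adic_doubling UNIV M n C" "0 \<le> k \<longleftrightarrow> 0 \<le> l"
  shows "emeasure M (cell 1 k) \<le> ennreal C * emeasure M (cell 1 l)"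
proof -
  define n where "n = nat (\<bar>k\<bar> + \<bar>l\<bar>) + 2"
  \<comment> \<open>\<open>c * n\<close> is the left endpoint of the common parent.\<close>
  define c :: int where "c = (if 0 \<le> k then 0 else - 1)"
  have child: "cell 1 r = adic_child n (-1) (c + 1) (nat (r - c * int n) + 1)"
    if "r \<ge> c * int n" for r
    using that by (simp add: adic_child_def cell_1 power_int_minus divide_inverse add_ac)
  have "k \<ge> c * int n" "l \<ge> c * int n" "nat (k - c * int n) + 1 \<in> {1..n}"
    "nat (l - c * int n) + 1 \<in> {1..n}"
    using assms(2) by (auto simp: c_def n_def nat_less_iff)
  then have "adic_siblings UNIV n (cell 1 k) (cell 1 l)"
    unfolding adic_siblings_def using child by (metis subset_UNIV)
  moreover have "n \<ge> 2" by (simp add: n_def)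
  ultimately show ?thesis using assms(1) unfolding adic_doubling_def by blast
qed

section \<open>Doubling on the line and on the torus\<close>

text \<open>The last step for both spaces: the factors \<open>2 * U\<close> and \<open>L / 2\<close>
  are those of \<open>interval_bounds\<close>, and their quotient is the doubling constant.\<close>

lemma doubling_if_comparable_to_length:
  fixes L U :: real
  assumes "L > 0" "U > 0"
    and "\<And>I1 I2. adj I1 I2 \<Longrightarrow>
      \<exists>l>0. emeasure M I1 \<le> ennreal (2 * U * l) \<and> ennreal (L / 2 * l) \<le> emeasure M I2"
  shows "doubling adj M"
  unfolding doubling_def
proof (intro exI conjI allI impI)
  show "4 * U / L > 0" using assms by simp
  fix I1 I2 assume "adj I1 I2"
  then obtain l where l: "l > 0" "emeasure M I1 \<le> ennreal (2 * U * l)"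
    "ennreal (L / 2 * l) \<le> emeasure M I2" using assms(3) by blast
  have "2 * U * l = 4 * U / L * (L / 2 * l)" using assms by simp
  then have "ennreal (2 * U * l) = ennreal (4 * U / L) * ennreal (L / 2 * l)"
    using assms l by (simp add: ennreal_mult[symmetric])
  also have "\<dots> \<le> ennreal (4 * U / L) * emeasure M I2"
    using l by (intro mult_left_mono) auto
  finally show "emeasure M I1 \<le> ennreal (4 * U / L) * emeasure M I2" using l by order
qed

text \<open>An arc of length at most 1 wraps around at most once, so in \<open>[0,1)\<close> it is
  one interval or a final piece together with an initial one.\<close>

lemma frac_image_interval:
  fixes a l :: real
  assumes "0 < l" "l \<le> 1"
  shows "frac ` {a..<a + l} =
    (if frac a + l \<le> 1 then {frac a..<frac a + l} else {frac a..<1} \<union> {0..<frac a + l - 1})"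
proof -
  have "x \<in> frac ` {a..<a + l} \<longleftrightarrow>
    0 \<le> x \<and> x < 1 \<and> (frac a \<le> x \<and> x < frac a + l \<or> x + 1 < frac a + l)" for x
  proof
    assume "x \<in> frac ` {a..<a + l}"
    then obtain y where y: "a \<le> y" "y < a + l" "x = frac y" by auto
    have fa: "\<lfloor>a\<rfloor> \<le> a" "a < \<lfloor>a\<rfloor> + 1" by linarith+
    have "\<lfloor>y\<rfloor> = \<lfloor>a\<rfloor> \<or> \<lfloor>y\<rfloor> = \<lfloor>a\<rfloor> + 1"
      using y assms by linarith
    then show "0 \<le> x \<and> x < 1 \<and> (frac a \<le> x \<and> x < frac a + l \<or> x + 1 < frac a + l)"
      using y frac_lt_1[of y] frac_ge_0[of y] unfolding frac_def by auto
  next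
    assume x: "0 \<le> x \<and> x < 1 \<and> (frac a \<le> x \<and> x < frac a + l \<or> x + 1 < frac a + l)"
    show "x \<in> frac ` {a..<a + l}"
    proof (cases "frac a \<le> x \<and> x < frac a + l")
      case True
      have "x = frac (x + of_int \<lfloor>a\<rfloor>)"
        using x by (simp add: frac_eq)
      moreover have "x + of_int \<lfloor>a\<rfloor> \<in> {a..<a + l}" using True unfolding frac_def by auto
      ultimately show ?thesis by blast
    next
      case False
      \<comment> \<open>Here \<open>x + 1 < frac a + l\<close>: the point lies beyond the wrap, so
        its lift is one integer higher.\<close>
      have "x = frac (x + of_int (\<lfloor>a\<rfloor> + 1))"
        using x by (simp only: frac_add_of_int_right) (simp add: frac_eq)
      moreover have "x + of_int (\<lfloor>a\<rfloor> + 1) \<in> {a..<a + l}"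
        using False x frac_lt_1[of a] unfolding frac_def by auto
      ultimately show ?thesis by blast
    qed
  qed
  then show ?thesis using assms frac_lt_1[of a] by (auto simp: set_eq_iff intro: order_trans[OF frac_ge_0])
qed

lemma doubling_line:
  assumes sets: "sets M = sets borel"
    and nondeg: "nondegenerate_on {..<0} M" "nondegenerate_on {0..} M"
    and unif: "uniformly_adic_doubling UNIV M"
  shows "doubling adjacent_line M"
proof -
  obtain C where C: "C > 0" "\<And>n. n \<ge> 2 \<Longrightarrow> adic_doubling UNIV M n C"
    using unif unfolding uniformly_adic_doubling_def by blast
  have meas: "intervals_measurable K M" for K
    by (simp add: intervals_measurable_def sets)
  have sib: "emeasure M (cell n i) \<le> ennreal C * emeasure M (cell n j)"
    if "n \<ge> 2" "i div int n = j div int n" for n i j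
    by (rule adic_doubling_cell[OF C(2)]) (use that in auto)
  note unit = adic_doubling_unit[OF C(2)]
  have sets_eq: "{x. \<lfloor>x\<rfloor> \<in> {0..}} = {0::real..}" "{x. \<lfloor>x\<rfloor> \<in> {..<0}} = {..<0::real}" by auto
  obtain L1 U1 where 1: "L1 > 0" "U1 > 0"
    "\<And>n i. n \<ge> 2 \<Longrightarrow> i div int n \<in> {0..} \<Longrightarrow> ennreal (L1 / n) \<le> emeasure M (cell n i)"
    "\<And>n i. n \<ge> 2 \<Longrightarrow> i div int n \<in> {0..} \<Longrightarrow> emeasure M (cell n i) \<le> ennreal (U1 / n)"
    by (rule cell_bounds[of "{0..}" M C]) (use meas C sib unit nondeg sets_eq in auto)
  obtain L2 U2 where 2: "L2 > 0" "U2 > 0"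
    "\<And>n i. n \<ge> 2 \<Longrightarrow> i div int n \<in> {..<0} \<Longrightarrow> ennreal (L2 / n) \<le> emeasure M (cell n i)"
    "\<And>n i. n \<ge> 2 \<Longrightarrow> i div int n \<in> {..<0} \<Longrightarrow> emeasure M (cell n i) \<le> ennreal (U2 / n)"
    by (rule cell_bounds[of "{..<0}" M C]) (use meas C sib unit nondeg sets_eq in auto)
  \<comment> \<open>Every cell lies on one side of 0, so the worse of the two pairs of constants
    bounds all cells.\<close>
  define L U where "L = min L1 L2" and "U = max U1 U2"
  have LU: "L > 0" "U > 0" using 1 2 by (auto simp: L_def U_def)
  have lower: "ennreal (L / n) \<le> emeasure M (cell n i)" if "n \<ge> 2" for n i
  proof -
    have "ennreal (L / n) \<le> ennreal (L1 / n)" "ennreal (L / n) \<le> ennreal (L2 / n)"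
      by (auto intro!: ennreal_leI divide_right_mono simp: L_def)
    then show ?thesis
      using 1(3)[OF that, of i] 2(3)[OF that, of i] by (cases "i div int n \<ge> 0") auto
  qed
  have upper: "emeasure M (cell n i) \<le> ennreal (U / n)" if "n \<ge> 2" for n i
  proof -
    have "ennreal (U1 / n) \<le> ennreal (U / n)" "ennreal (U2 / n) \<le> ennreal (U / n)"
      by (auto intro!: ennreal_leI divide_right_mono simp: U_def)
    then show ?thesis
      using 1(4)[OF that, of i] 2(4)[OF that, of i] by (cases "i div int n \<ge> 0") auto
  qed
  \<comment> \<open>With \<open>K = UNIV\<close> the two sides are joined: intervals across 0 are
    covered although no siblings lie on both sides.\<close>
  note bounds = interval_bounds[OF meas[of UNIV] LU lower upper]
  show ?thesis
  proof (rule doubling_if_comparable_to_length[OF LU])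
    fix I1 I2 assume "adjacent_line I1 I2"
    then obtain a l where l: "l > 0" and
      I: "I1 = {a..<a + l} \<and> I2 = {a + l..<a + 2 * l} \<or>
          I1 = {a + l..<a + 2 * l} \<and> I2 = {a..<a + l}"
      unfolding adjacent_line_def by blast
    have "ennreal (L / 2 * l) \<le> emeasure M J \<and> emeasure M J \<le> ennreal (2 * U * l)"
      if "J = I1 \<or> J = I2" for J
      using that I bounds[of a "a + l"] bounds[of "a + l" "a + 2 * l"] l by auto
    then show "\<exists>l>0. emeasure M I1 \<le> ennreal (2 * U * l) \<and> ennreal (L / 2 * l) \<le> emeasure M I2"
      using l by blast
  qed
qed

lemma doubling_torus:
  assumes sets: "sets M = sets borel_torus"
    and nondeg: "nondegenerate_on {0..<1} M"
    and unif: "uniformly_adic_doubling {0..<1} M"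
  shows "doubling adjacent_torus M"
proof -
  obtain C where C: "C > 0" "\<And>n. n \<ge> 2 \<Longrightarrow> adic_doubling {0..<1} M n C"
    using unif unfolding uniformly_adic_doubling_def by blast
  have unit_eq: "{x. \<lfloor>x\<rfloor> \<in> {0}} = {0::real..<1}" by (auto simp: floor_eq_iff)
  have meas: "intervals_measurable {0} M"
    unfolding intervals_measurable_def unit_eq sets borel_torus_def
    by (auto simp: sets_restrict_space_iff)
  \<comment> \<open>The only unit interval is compared with itself, which is immediate once the
    constant is at least 1.\<close>
  define C' where "C' = max 1 C"
  have C': "C' > 0" by (simp add: C'_def)
  have sib: "emeasure M (cell n i) \<le> ennreal C' * emeasure M (cell n j)"
    if "n \<ge> 2" "i div int n \<in> {0}" "i div int n = j div int n" for n i j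
  proof -
    have "emeasure M (cell n i) \<le> ennreal C * emeasure M (cell n j)"
      by (rule adic_doubling_cell[OF C(2)]) (use that in \<open>auto simp: cell_1 cell_def\<close>)
    also have "\<dots> \<le> ennreal C' * emeasure M (cell n j)"
      by (intro mult_right_mono ennreal_leI) (auto simp: C'_def)
    finally show ?thesis .
  qed
  have unit: "emeasure M (cell 1 k) \<le> ennreal C' * emeasure M (cell 1 l)"
    if "k \<in> {0}" "l \<in> {0}" for k l
    using that mult_right_mono[of 1 "ennreal C'" "emeasure M (cell 1 0)"]
    by (simp add: C'_def)
  obtain L U where LU: "L > 0" "U > 0"
    "\<And>n i. n \<ge> 2 \<Longrightarrow> i div int n \<in> {0} \<Longrightarrow> ennreal (L / n) \<le> emeasure M (cell n i)"
    "\<And>n i. n \<ge> 2 \<Longrightarrow> i div int n \<in> {0} \<Longrightarrow> emeasure M (cell n i) \<le> ennreal (U / n)"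
    by (rule cell_bounds[OF meas C' sib unit]) (use nondeg unit_eq in auto)
  note bounds = interval_bounds[OF meas LU, unfolded unit_eq]
  have frac_bounds: "ennreal (L / 2 * l) \<le> emeasure M (frac ` {a..<a + l})"
    "emeasure M (frac ` {a..<a + l}) \<le> ennreal (2 * U * l)" if l: "0 < l" "l \<le> 1" for a l
  proof -
    have f: "0 \<le> frac a" "frac a < 1" by (auto simp: frac_lt_1)
    have "ennreal (L / 2 * l) \<le> emeasure M (frac ` {a..<a + l}) \<and>
      emeasure M (frac ` {a..<a + l}) \<le> ennreal (2 * U * l)"
    proof (cases "frac a + l \<le> 1")
      case True
      then show ?thesis
        using bounds[of "frac a" "frac a + l"] l f by (auto simp: frac_image_interval[OF l])
    next
      case False
      \<comment> \<open>Both pieces have positive length and the lengths add up to \<open>l\<close>.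
        As the bounds are linear in the length, adding them loses nothing.\<close>
      let ?A = "{frac a..<1}" and ?B = "{0..<frac a + l - 1}"
      have "?A \<subseteq> {0..<1}" "?B \<subseteq> {0..<1}" using l f by auto
      then have "?A \<in> sets M" "?B \<in> sets M"
        using meas unfolding intervals_measurable_def unit_eq by blast+
      moreover have "?A \<inter> ?B = {}" using l by auto
      ultimately have eq: "emeasure M (frac ` {a..<a + l}) = emeasure M ?A + emeasure M ?B"
        using False l by (simp add: frac_image_interval plus_emeasure)
      have A: "ennreal (L / 2 * (1 - frac a)) \<le> emeasure M ?A"
        "emeasure M ?A \<le> ennreal (2 * U * (1 - frac a))"
        using bounds[of "frac a" 1] f by auto
      have B: "ennreal (L / 2 * (frac a + l - 1)) \<le> emeasure M ?B"
        "emeasure M ?B \<le> ennreal (2 * U * (frac a + l - 1))"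
        using bounds[of 0 "frac a + l - 1"] f l False by auto
      have split: "ennreal (c * l) = ennreal (c * (1 - frac a)) + ennreal (c * (frac a + l - 1))"
        if "c > 0" for c
      proof -
        have "0 \<le> c * (1 - frac a)" "0 \<le> c * (frac a + l - 1)"
          using that f False by (intro mult_nonneg_nonneg; simp)+
        then have "ennreal (c * (1 - frac a)) + ennreal (c * (frac a + l - 1)) =
          ennreal (c * (1 - frac a) + c * (frac a + l - 1))"
          by (rule ennreal_plus[symmetric])
        then show ?thesis by (simp add: algebra_simps)
      qed
      show ?thesis
        unfolding eq using A B split[of "L / 2"] split[of "2 * U"] LU(1,2) by (simp add: add_mono)
    qed
    then show "ennreal (L / 2 * l) \<le> emeasure M (frac ` {a..<a + l})"
      "emeasure M (frac ` {a..<a + l}) \<le> ennreal (2 * U * l)" by auto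
  qed
  show ?thesis
  proof (rule doubling_if_comparable_to_length[OF LU(1,2)])
    fix I1 I2 assume "adjacent_torus I1 I2"
    \<comment> \<open>Writing \<open>2 * l\<close> as \<open>l + l\<close> presents the second arc
      as starting at \<open>a + l\<close> with length \<open>l\<close>, the form of
      \<open>frac_bounds\<close>.\<close>
    then obtain a l where l: "l > 0" "l + l \<le> 1" and
      I: "I1 = frac ` {a..<a + l} \<and> I2 = frac ` {a + l..<a + l + l} \<or>
          I1 = frac ` {a + l..<a + l + l} \<and> I2 = frac ` {a..<a + l}"
      unfolding adjacent_torus_def mult_2 add.assoc[symmetric] by blast
    have "ennreal (L / 2 * l) \<le> emeasure M J \<and> emeasure M J \<le> ennreal (2 * U * l)"
      if "J = I1 \<or> J = I2" for J
      using that I frac_bounds[of l a] frac_bounds[of l "a + l"] l by auto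
    then show "\<exists>l>0. emeasure M I1 \<le> ennreal (2 * U * l) \<and> ennreal (L / 2 * l) \<le> emeasure M I2"
      using l by blast
  qed
qed

theorem theorem1p2:
  fixes \<mu> :: "real measure"
  shows "(sets \<mu> = sets borel \<and> nondegenerate_on {..<0} \<mu> \<and> nondegenerate_on {0..} \<mu> \<and>
            uniformly_adic_doubling UNIV \<mu> \<longrightarrow> doubling adjacent_line \<mu>) \<and>
         (sets \<mu> = sets borel_torus \<and> nondegenerate_on {0..<1} \<mu> \<and>
            uniformly_adic_doubling {0..<1} \<mu> \<longrightarrow> doubling adjacent_torus \<mu>)"
  using doubling_line doubling_torus by blast

end
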